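(* Let $k$ be a field. Then $UT_2(k)$ satisfies a (non-trivial) semigroup identity if and only if $k$ is finite.
   Context: $UT_2(k)$ is the monoid of $2\times 2$ upper triangular matrices over $k$ under matrix multiplication (matrices are not required to be invertible). A semigroup identity is a pair $u=v$ of words in the free semigroup $\Sigma^+$ over an alphabet $\Sigma$; it is non-trivial if $u\neq v$ as words, and it is satisfied by a semigroup $M$ if $g(u)=g(v)$ for every semigroup morphism $g:\Sigma^+\to M$. *)

theory Defs
  imports "HOL-Algebra.Group" "HOL-Analysis.Cartesian_Space"
begin

(* A monoid record is used only to speak of morphisms through hom, which requires
   multiplicativity on the carrier and nothing about units; the unit field is junk, since the
   empty word is not in the carrier. *)
definition free_semigroup :: "'x set \<Rightarrow> 'x list monoid"
  where "free_semigroup \<Sigma> = \<lparr>carrier = lists \<Sigma> - {[]}, mult = (@), one = []\<rparr>"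

definition UT2 :: "('k::field^2^2) monoid"
  where "UT2 = \<lparr>carrier = {A. A $ 2 $ 1 = 0}, mult = (**), one = mat 1\<rparr>"

definition satisfies_identity :: "('m, 'e) monoid_scheme \<Rightarrow> 'x set \<Rightarrow> 'x list \<Rightarrow> 'x list \<Rightarrow> bool"
  where "satisfies_identity M \<Sigma> u v \<longleftrightarrow> (\<forall>g\<in>hom (free_semigroup \<Sigma>) M. g u = g v)"

(* A type cannot be quantified existentially, so the alphabets range over the sets of natural
   numbers; the lemma satisfies_nontrivial_identityI below shows that an identity over an alphabet
   of any type gives one of this form. *)
definition satisfies_nontrivial_identity :: "('m, 'e) monoid_scheme \<Rightarrow> bool"
  where "satisfies_nontrivial_identity M \<longleftrightarrow>
    (\<exists>\<Sigma>::nat set. \<exists>u\<in>carrier (free_semigroup \<Sigma>). \<exists>v\<in>carrier (free_semigroup \<Sigma>).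
      u \<noteq> v \<and> satisfies_identity M \<Sigma> u v)"

lemma satisfies_nontrivial_identityI:
  fixes \<Sigma> :: "'x set"
  assumes u: "u \<in> carrier (free_semigroup \<Sigma>)" and v: "v \<in> carrier (free_semigroup \<Sigma>)"
    and ne: "u \<noteq> v" and sat: "satisfies_identity M \<Sigma> u v"
  shows "satisfies_nontrivial_identity M"
proof -
  let ?S = "set u \<union> set v"
  obtain f :: "'x \<Rightarrow> nat" where f: "inj_on f ?S"
    using finite_imp_inj_to_nat_seg[of ?S] by auto
  define f' where "f' x = (if x \<in> ?S then f x else f (hd u))" for x
  let ?T = "f ` ?S"
  have une: "u \<noteq> []" and vne: "v \<noteq> []"
    using u v by (auto simp: free_semigroup_def)
  have range: "f' x \<in> ?T" for x
    using une by (auto simp: f'_def)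
  have inj: "inj_on f' ?S"
    using f unfolding inj_on_def f'_def by auto
  have mem: "map f' u \<in> carrier (free_semigroup ?T)" "map f' v \<in> carrier (free_semigroup ?T)"
    using une vne range by (auto simp: free_semigroup_def)
  have ne': "map f' u \<noteq> map f' v"
    using ne inj by (simp add: inj_on_map_eq_map)
  have "g (map f' u) = g (map f' v)" if g: "g \<in> hom (free_semigroup ?T) M" for g
  proof -
    have "(\<lambda>w. g (map f' w)) \<in> hom (free_semigroup \<Sigma>) M"
      using g range by (auto simp: hom_def free_semigroup_def Pi_iff in_lists_conv_set simp del: image_Un)
    then show ?thesis
      using sat by (auto simp: satisfies_identity_def)
  qed
  then show ?thesis
    unfolding satisfies_nontrivial_identity_def satisfies_identity_def
    using mem ne' by blast
qed

lemma monoid_UT2: "monoid (UT2 :: ('k::field^2^2) monoid)"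
proof -
  have "A ** B \<in> {A. A $ 2 $ 1 = 0}" if "A $ 2 $ 1 = 0" "B $ 2 $ 1 = 0" for A B :: "'k^2^2"
    using that by (simp add: matrix_matrix_mult_def sum_2)
  moreover have "(mat 1 :: 'k^2^2) $ 2 $ 1 = 0"
    by (simp add: mat_def)
  ultimately show ?thesis
    by unfold_locales (auto simp: UT2_def matrix_mul_assoc)
qed

end

theory Submission
  imports Defs "HOL-Computational_Algebra.Polynomial"
begin

text \<open>
  Over a finite field the monoid is finite, and a finite monoid satisfies an identity in one letter:
  the power maps \<open>x \<mapsto> x\<^sup>n\<close> are infinitely many self-maps of a finite set, so two of them
  coincide.

  Over an infinite field, a word can be read off from its values under affine substitutions. Send
  every letter to a matrix with diagonal \<open>(t, 1)\<close> whose upper right entry is 1 for one chosen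
  letter \<open>x\<close> and 0 for the others. The upper right entry of the image of a word is then the sum
  of \<open>t ^ i\<close> over the positions \<open>i\<close> at which \<open>x\<close> occurs. This is a polynomial in \<open>t\<close> with
  coefficients 0 and 1, so in any characteristic its coefficients record the positions of \<open>x\<close>; over
  an infinite field the polynomial is determined by its values. Hence two sides of an identity have
  every letter in the same positions, that is, they are the same word.
\<close>

lemma finite_monoid_satisfies_nontrivial_identity:
  assumes "monoid M" and fin: "finite (carrier M)"
  shows "satisfies_nontrivial_identity M"
proof -
  interpret monoid M by fact
  \<comment> \<open>The exponent starts at 1 because the empty word is not allowed in an identity.\<close>
  define power_map where
    "power_map n = restrict (\<lambda>a. a [^]\<^bsub>M\<^esub> Suc n) (carrier M)" for n :: nat
  have "range power_map \<subseteq> carrier M \<rightarrow>\<^sub>E carrier M"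
    unfolding power_map_def by (intro image_subsetI restrict_PiE_iff[THEN iffD2] ballI nat_pow_closed)
  moreover have "finite (carrier M \<rightarrow>\<^sub>E carrier M)"
    using fin by (intro finite_PiE)
  ultimately have "\<not> inj power_map"
    by (meson finite_subset infinite_UNIV_nat finite_imageD)
  then obtain m n where "m \<noteq> n" and eq: "power_map m = power_map n"
    by (auto simp: inj_def)
  define word where "word n = replicate (Suc n) (0::nat)" for n
  have eval: "g (word n) = g [0] [^]\<^bsub>M\<^esub> Suc n" if g: "g \<in> hom (free_semigroup {0}) M" for g n
  proof (induction n)
    case 0
    have "g [0] \<in> carrier M"
      using g by (auto simp: hom_def free_semigroup_def)
    then show ?case
      by (simp add: word_def)
  next
    case (Suc n)
    have "word (Suc n) = word n @ [0]"
      by (simp add: word_def replicate_append_same)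
    moreover have "word n \<in> lists {0} - {[]}" "[0] \<in> lists {0::nat} - {[]}"
      by (auto simp: word_def)
    then have "g (word n @ [0]) = g (word n) \<otimes>\<^bsub>M\<^esub> g [0]"
      using g by (simp add: hom_def free_semigroup_def)
    ultimately show ?case
      using Suc by simp
  qed
  have "satisfies_identity M {0} (word m) (word n)"
    unfolding satisfies_identity_def
  proof
    fix g assume g: "g \<in> hom (free_semigroup {0::nat}) M"
    then have "g [0] \<in> carrier M"
      by (auto simp: hom_def free_semigroup_def)
    then have "g [0] [^]\<^bsub>M\<^esub> Suc m = g [0] [^]\<^bsub>M\<^esub> Suc n"
      using fun_cong[OF eq, of "g [0]"] unfolding power_map_def by (simp only: restrict_apply if_True)
    then show "g (word m) = g (word n)"
      using eval[OF g] by simp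
  qed
  moreover have "word m \<noteq> word n"
  proof
    assume "word m = word n"
    then have "length (word m) = length (word n)" by simp
    with \<open>m \<noteq> n\<close> show False by (simp add: word_def)
  qed
  ultimately show ?thesis
    by (intro satisfies_nontrivial_identityI[of "word m" "{0}" "word n"])
      (auto simp: free_semigroup_def word_def)
qed

definition position_poly :: "'x \<Rightarrow> 'x list \<Rightarrow> 'k::field poly"
  where "position_poly x w = Poly (map (\<lambda>y. of_bool (y = x)) w)"

lemma coeff_position_poly:
  "coeff (position_poly x w) i = of_bool (i < length w \<and> w ! i = x)"
  by (simp add: position_poly_def nth_default_def)

lemma poly_position_poly_append:
  "poly (position_poly x (u @ v)) t
    = poly (position_poly x u) t + t ^ length u * poly (position_poly x v) t"
  by (simp add: position_poly_def Poly_append poly_monom)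

lemma words_eqI_position_poly:
  assumes "\<And>x. position_poly x u = (position_poly x v :: 'k::field poly)"
  shows "u = v"
proof -
  have "(i < length u \<and> u ! i = x) \<longleftrightarrow> (i < length v \<and> v ! i = x)" for i x
    using arg_cong[OF assms[of x], of "\<lambda>p. coeff p i"]
    by (simp only: coeff_position_poly of_bool_eq_iff)
  then show ?thesis
    by (metis linorder_neqE_nat nth_equalityI less_irrefl)
qed

lemma poly_eqI_infinite_field:
  fixes p q :: "'k::field poly"
  assumes "infinite (UNIV :: 'k set)" and "\<And>t. poly p t = poly q t"
  shows "p = q"
  using poly_roots_finite[of "p - q"] assms by auto

text \<open>
  The morphism sending each letter to a matrix with diagonal \<open>(t, 1)\<close> and upper right entry 1 for
  the letter \<open>x\<close>, 0 for the others, written in closed form. The lower right entry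
  being 1 makes the positions count from the left, starting at 0.
\<close>

definition position_matrix :: "'k::field \<Rightarrow> 'x \<Rightarrow> 'x list \<Rightarrow> 'k^2^2"
  where "position_matrix t x w =
    vector [vector [t ^ length w, poly (position_poly x w) t], vector [0, 1]]"

lemma position_matrix_hom: "position_matrix t x \<in> hom (free_semigroup \<Sigma>) UT2"
  by (auto simp: hom_def free_semigroup_def UT2_def position_matrix_def vec_eq_iff forall_2
      matrix_matrix_mult_def sum_2 power_add poly_position_poly_append algebra_simps)

lemma UT2_identity_imp_eq:
  assumes "infinite (UNIV :: 'k::field set)"
    and sat: "satisfies_identity (UT2 :: ('k^2^2) monoid) \<Sigma> u v"
  shows "u = v"
proof (rule words_eqI_position_poly[where 'k = 'k])
  fix x
  have "poly (position_poly x u) t = poly (position_poly x v) t" for t :: 'k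
  proof -
    have "position_matrix t x u = position_matrix t x v"
      using sat unfolding satisfies_identity_def by (rule bspec[OF _ position_matrix_hom])
    then have "position_matrix t x u $ 1 $ 2 = position_matrix t x v $ 1 $ 2"
      by simp
    then show ?thesis
      by (simp add: position_matrix_def)
  qed
  then show "position_poly x u = (position_poly x v :: 'k poly)"
    using assms(1) by (intro poly_eqI_infinite_field)
qed

theorem corollary4p3:
  shows "satisfies_nontrivial_identity (UT2 :: ('k::field^2^2) monoid) \<longleftrightarrow> finite (UNIV :: 'k set)"
proof
  assume "satisfies_nontrivial_identity (UT2 :: ('k^2^2) monoid)"
  then show "finite (UNIV :: 'k set)"
    using UT2_identity_imp_eq unfolding satisfies_nontrivial_identity_def by blast
next
  assume fin: "finite (UNIV :: 'k set)"
  define entries where "entries A = ((A $ 1 $ 1, A $ 1 $ 2), (A $ 2 $ 1, A $ 2 $ 2))" for A :: "'k^2^2"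
  have "inj entries"
    by (auto simp: inj_def entries_def vec_eq_iff forall_2)
  moreover have "finite (UNIV :: (('k \<times> 'k) \<times> ('k \<times> 'k)) set)"
    using fin by (intro finite_Prod_UNIV)
  ultimately have "finite (UNIV :: ('k^2^2) set)"
    by (meson finite_imageD finite_subset subset_UNIV)
  then show "satisfies_nontrivial_identity (UT2 :: ('k^2^2) monoid)"
    by (meson finite_monoid_satisfies_nontrivial_identity finite_subset monoid_UT2 subset_UNIV)
qed

end
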